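(* Let $(x,p,p^0,u)$ be an extremal, with final time $T>0$, of the minimum-time problem $\mathbf{OCP}$ of reaching $\partial\mathcal{S}$ from $\bar{x}_0\in\mathcal{S}$; that is, $p:[0,T]\to\mathbb{R}^n$ is absolutely continuous, $p^0\in\{-1,0\}$, $(p,p^0)\neq 0$, $x_0=\bar x_0$, and $$\dot{x}_t=f(x_t)+g(x_t)u_t,\qquad \dot{p}_t=-(\nabla f(x_t)+\nabla g(x_t)u_t)^\top p_t,\qquad u_t\in\mathop{\arg\max}_{v\in\mathcal{U}}\,p_t^\top g(x_t)v,$$ $$x_T\in\partial\mathcal{S},\qquad p_T\perp T_{x_T}\partial\mathcal{S},\qquad p_T^\top(f(x_T)+g(x_T)u_T)=-p^0.$$ Assume that: (A1) the tangent space $T_{x_T}\partial\mathcal{S}$ is of dimension $n-1$; (A2) $x_t\in\mathcal{S}$ for all $t\in[0,T]$; (A3) for some $\epsilon>0$, the control $u$ can be smoothly extended over $(T,T+\epsilon)$ such that the corresponding state trajectory satisfies $x_t\in\mathcal{S}$ for all $t\in[0,T+\epsilon)$; (A4) $\mathcal{S}=\{x\in\mathbb{R}^n:h(x)\geq 0\}$ where $h:\mathbb{R}^n\to\mathbb{R}$ is continuously differentiable and a submersion at $x_T$ (i.e., $\nabla h(x_T)$ has full rank one). Then $p^0=0$, so $(x,p,p^0,u)$ satisfies $$\begin{cases} \dot{x}_t=f(x_t)+g(x_t)u_t,\\ \dot{p}_t=-(\nabla f(x_t)+\nabla g(x_t)u_t)^\top p_t,\\ u_t\in\mathop{\arg\max}_{v\in\mathcal{U}}\,p_t^\top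 g(x_t)v,\\ h(x_T)=0,\\ p_T=\nabla h(x_T),\\ p_T^\top(f(x_T)+g(x_T)u_T)=0. \end{cases}$$
   Context: Dynamics: $\dot{x}_t=f(x_t)+g(x_t)u_t$ with state $x_t\in\mathbb{R}^n$ and control $u_t\in\mathcal{U}\subset\mathbb{R}^m$ ($\mathcal{U}$ is the admissible control set), where $f:\mathbb{R}^n\to\mathbb{R}^n$ and $g:\mathbb{R}^n\to\mathbb{R}^{n\times m}$ are Lipschitz and differentiable with Lipschitz Jacobians. $\nabla f(x)$ is the Jacobian of $f$, and $\nabla g(x)u$ denotes the Jacobian at $x$ of $y\mapsto g(y)u$ with $u$ fixed. $\mathcal{S}\subset\mathbb{R}^n$ is the safe set, $\partial\mathcal{S}$ its boundary, and $T_{x_T}\partial\mathcal{S}$ the tangent space of $\partial\mathcal{S}$ at $x_T$. $\mathbf{OCP}$ is the free-final-time optimal control problem: given a fixed $\bar{x}_0$ inside $\mathcal{S}$, minimize $T$ over pairs $(u,T)$ subject to $\dot{x}_t=f(x_t)+g(x_t)u_t$ for $t\in[0,T]$, $x_0=\bar{x}_0$, and $x_T\in\partial\mathcal{S}$. An extremal is a tuple $(x,p,p^0,u)$ satisfying the first set of conditions displayed in the claim (the necessary optimality conditions of the Pontryagin Maximum Principle); it is called normal if $p^0=-1$ and abnormal if $p^0=0$. Convention for (A3): a smooth extension of $u$ is a control $\tilde u:[0,T+\epsilon)\to\mathcal{U}$ with $\tilde u=u$ on $[0,T]$ that continues $u$ smoothly past time $T$ (in particular $\tilde u$ is smooth on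 $[T,T+\epsilon)$ with $\tilde u_T=u_T$, so there is no jump in the control at $T$), and $x$ on $[0,T+\epsilon)$ is the trajectory driven by $\tilde u$.
   Formalization: The line p_T = ∇h(x_T) fails in general (a costate with p^0 = 0 can be rescaled, and can point along −∇h); proved instead: for some c > 0 the rescaled costate q = c p satisfies all the conditions with q_T = ∇h(x_T) or q_T = −∇h(x_T). *)

theory Defs
  imports "HOL-Analysis.Analysis"
begin

definition lipschitz_with_lipschitz_derivative ::
  "('a::euclidean_space \<Rightarrow> 'b::euclidean_space) \<Rightarrow> bool"
  where "lipschitz_with_lipschitz_derivative F \<longleftrightarrow>
    (\<exists>L. L-lipschitz_on UNIV F) \<and>
    (\<forall>x. F differentiable at x) \<and>
    (\<exists>L. \<forall>x y. onorm (\<lambda>v. frechet_derivative F (at x) v - frechet_derivative F (at y) v)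
                \<le> L * dist x y)"

text \<open>Epsilon-delta absolute continuity of a curve. The sets in \<^term>\<open>D\<close> range over finite
  families of non-overlapping compact subintervals.\<close>

definition absolutely_continuous_on :: "real set \<Rightarrow> (real \<Rightarrow> 'a::real_normed_vector) \<Rightarrow> bool"
  where "absolutely_continuous_on I F \<longleftrightarrow>
    (\<forall>e>0. \<exists>d>0. \<forall>D. D division_of (\<Union>D) \<and> \<Union>D \<subseteq> I \<and> (\<Sum>K\<in>D. Sup K - Inf K) < d \<longrightarrow>
        (\<Sum>K\<in>D. norm (F (Sup K) - F (Inf K))) < e)"

text \<open>Caratheodory solution on an interval \<^term>\<open>J\<close>: absolutely continuous on every compact
  subinterval, with the equation holding almost everywhere. The velocity \<^term>\<open>w\<close> is given as a
  function of time, i.e. already evaluated along the curve.\<close>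

definition has_velocity_ae :: "(real \<Rightarrow> 'a::euclidean_space) \<Rightarrow> (real \<Rightarrow> 'a) \<Rightarrow> real set \<Rightarrow> bool"
  where "has_velocity_ae y w J \<longleftrightarrow>
    (\<forall>a b. {a..b} \<subseteq> J \<longrightarrow> absolutely_continuous_on {a..b} y) \<and>
    (AE t in lebesgue_on J. (y has_vector_derivative w t) (at t within J))"

definition state_trajectory ::
  "(real^'n \<Rightarrow> real^'n) \<Rightarrow> (real^'n \<Rightarrow> real^'m^'n) \<Rightarrow> (real \<Rightarrow> real^'m) \<Rightarrow> real set
    \<Rightarrow> (real \<Rightarrow> real^'n) \<Rightarrow> bool"
  where "state_trajectory f g u J x \<longleftrightarrow>
    has_velocity_ae x (\<lambda>t. f (x t) + g (x t) *v u t) J"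

definition costate_trajectory ::
  "(real^'n \<Rightarrow> real^'n) \<Rightarrow> (real^'n \<Rightarrow> real^'m^'n) \<Rightarrow> (real \<Rightarrow> real^'m) \<Rightarrow> (real \<Rightarrow> real^'n)
    \<Rightarrow> real set \<Rightarrow> (real \<Rightarrow> real^'n) \<Rightarrow> bool"
  where "costate_trajectory f g u x J p \<longleftrightarrow>
    has_velocity_ae p
      (\<lambda>t. - (transpose (jacobian f (at (x t)) + jacobian (\<lambda>y. g y *v u t) (at (x t))) *v p t)) J"

definition maximizing_control ::
  "(real^'n \<Rightarrow> real^'m^'n) \<Rightarrow> (real^'m) set \<Rightarrow> (real \<Rightarrow> real^'m) \<Rightarrow> (real \<Rightarrow> real^'n)
    \<Rightarrow> real set \<Rightarrow> (real \<Rightarrow> real^'n) \<Rightarrow> bool"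
  where "maximizing_control g U u x J p \<longleftrightarrow>
    (AE t in lebesgue_on J. is_arg_max (\<lambda>v. p t \<bullet> (g (x t) *v v)) (\<lambda>v. v \<in> U) (u t))"

text \<open>Measurable, essentially bounded controls. The constraint is imposed at every time, because
  the value of the control at the final time enters the transversality condition.\<close>

definition admissible_control :: "(real^'m) set \<Rightarrow> real \<Rightarrow> (real \<Rightarrow> real^'m) \<Rightarrow> bool"
  where "admissible_control U T u \<longleftrightarrow>
    u \<in> borel_measurable (lebesgue_on {0..T}) \<and>
    (\<exists>B. AE t in lebesgue_on {0..T}. norm (u t) \<le> B) \<and>
    (\<forall>t\<in>{0..T}. u t \<in> U)"

text \<open>Velocities at \<^term>\<open>a\<close> of continuously differentiable curves lying in \<^term>\<open>M\<close>.\<close>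

definition tangent_space :: "'a::euclidean_space set \<Rightarrow> 'a \<Rightarrow> 'a set"
  where "tangent_space M a =
    {v. \<exists>c. \<exists>e>0. c C1_differentiable_on {-e<..<e} \<and> c ` {-e<..<e} \<subseteq> M \<and>
          c 0 = a \<and> (c has_vector_derivative v) (at 0)}"

definition extremal ::
  "(real^'n \<Rightarrow> real^'n) \<Rightarrow> (real^'n \<Rightarrow> real^'m^'n) \<Rightarrow> (real^'m) set \<Rightarrow> (real^'n) set \<Rightarrow> real^'n
    \<Rightarrow> real \<Rightarrow> (real \<Rightarrow> real^'n) \<Rightarrow> (real \<Rightarrow> real^'n) \<Rightarrow> real \<Rightarrow> (real \<Rightarrow> real^'m) \<Rightarrow> bool"
  where "extremal f g U S x0 T x p p0 u \<longleftrightarrow>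
    admissible_control U T u \<and>
    p0 \<in> {-1, 0} \<and>
    (p0 \<noteq> 0 \<or> (\<exists>t\<in>{0..T}. p t \<noteq> 0)) \<and>
    x 0 = x0 \<and>
    state_trajectory f g u {0..T} x \<and>
    costate_trajectory f g u x {0..T} p \<and>
    maximizing_control g U u x {0..T} p \<and>
    x T \<in> frontier S \<and>
    (\<forall>v\<in>tangent_space (frontier S) (x T). orthogonal (p T) v) \<and>
    p T \<bullet> (f (x T) + g (x T) *v u T) = - p0"

text \<open>Infinite differentiability, with one-sided derivatives at endpoints belonging to the
  interval \<^term>\<open>J\<close>; \<^term>\<open>D k\<close> is the derivative of order \<^term>\<open>k\<close>.\<close>

definition smooth_on_interval :: "real set \<Rightarrow> (real \<Rightarrow> 'a::real_normed_vector) \<Rightarrow> bool"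
  where "smooth_on_interval J F \<longleftrightarrow>
    (\<exists>D :: nat \<Rightarrow> real \<Rightarrow> 'a.
        (\<forall>t\<in>J. D 0 t = F t) \<and>
        (\<forall>k. \<forall>t\<in>J. (D k has_vector_derivative D (Suc k) t) (at t within J)))"

definition smooth_safe_extension ::
  "(real^'n \<Rightarrow> real^'n) \<Rightarrow> (real^'n \<Rightarrow> real^'m^'n) \<Rightarrow> (real^'m) set \<Rightarrow> (real^'n) set \<Rightarrow> real
    \<Rightarrow> (real \<Rightarrow> real^'n) \<Rightarrow> (real \<Rightarrow> real^'m) \<Rightarrow> real
    \<Rightarrow> (real \<Rightarrow> real^'n) \<Rightarrow> (real \<Rightarrow> real^'m) \<Rightarrow> bool"
  where "smooth_safe_extension f g U S T x u e x' u' \<longleftrightarrow>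
    (\<forall>t\<in>{0..T}. u' t = u t) \<and>
    (\<forall>t\<in>{0..<T + e}. u' t \<in> U) \<and>
    smooth_on_interval {T..<T + e} u' \<and>
    (\<forall>t\<in>{0..T}. x' t = x t) \<and>
    state_trajectory f g u' {0..<T + e} x' \<and>
    (\<forall>t\<in>{0..<T + e}. x' t \<in> S)"

end

theory Submission
  imports Defs
begin

text \<open>By (A1) the tangent space of the boundary is the whole orthogonal complement of the gradient
  \<^term>\<open>q\<close> of \<^term>\<open>h\<close> at the final point, so the final costate is a multiple \<^term>\<open>c *\<^sub>R q\<close>.
  Let \<^term>\<open>v\<close> be the final velocity. The safe extension, along which the velocity is continuous,
  forces \<open>q \<bullet> v \<ge> 0\<close>. If the extremal were normal, then \<open>c (q \<bullet> v) = 1\<close> and hence \<open>c > 0\<close>. The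
  maximum condition then bounds the pairing of the costate with the velocity from below by a
  positive constant shortly before the final time, so \<^term>\<open>h\<close> increases to zero from strictly
  negative values, contradicting (A2). Finally \<open>c \<noteq> 0\<close>, because a costate vanishing at the final
  time vanishes identically.\<close>

subsection \<open>Absolutely continuous curves\<close>

lemma absolutely_continuous_onD:
  assumes "absolutely_continuous_on I F" "e > 0"
  obtains d where "d > 0"
    "\<And>D. \<lbrakk>D division_of (\<Union>D); \<Union>D \<subseteq> I; (\<Sum>K\<in>D. Sup K - Inf K) < d\<rbrakk>
      \<Longrightarrow> (\<Sum>K\<in>D. norm (F (Sup K) - F (Inf K))) < e"
  using assms unfolding absolutely_continuous_on_def by meson

lemma absolutely_continuous_on_bounded_linear:
  assumes F: "absolutely_continuous_on I F" and L: "bounded_linear L"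
  shows "absolutely_continuous_on I (\<lambda>t. L (F t))"
  unfolding absolutely_continuous_on_def
proof (intro allI impI)
  fix e :: real
  assume "e > 0"
  obtain C where C: "C > 0" "\<And>v. norm (L v) \<le> norm v * C"
    using bounded_linear.pos_bounded[OF L] by blast
  obtain d where d: "d > 0"
    "\<And>D. \<lbrakk>D division_of (\<Union>D); \<Union>D \<subseteq> I; (\<Sum>K\<in>D. Sup K - Inf K) < d\<rbrakk>
      \<Longrightarrow> (\<Sum>K\<in>D. norm (F (Sup K) - F (Inf K))) < e / C"
    using absolutely_continuous_onD[OF F divide_pos_pos[OF \<open>e > 0\<close> C(1)]] by blast
  have "(\<Sum>K\<in>D. norm (L (F (Sup K)) - L (F (Inf K)))) < e"
    if "D division_of (\<Union>D)" "\<Union>D \<subseteq> I" "(\<Sum>K\<in>D. Sup K - Inf K) < d" for D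
  proof -
    have "(\<Sum>K\<in>D. norm (L (F (Sup K)) - L (F (Inf K))))
        \<le> (\<Sum>K\<in>D. norm (F (Sup K) - F (Inf K)) * C)"
      by (intro sum_mono) (metis C(2) bounded_linear.linear[OF L] linear_diff)
    also have "\<dots> = (\<Sum>K\<in>D. norm (F (Sup K) - F (Inf K))) * C"
      by (simp add: sum_distrib_right)
    also have "\<dots> < e"
      using d(2)[OF that] C(1) by (simp add: field_simps)
    finally show ?thesis .
  qed
  with d(1) show "\<exists>d>0. \<forall>D. D division_of \<Union> D \<and> \<Union> D \<subseteq> I \<and> (\<Sum>K\<in>D. Sup K - Inf K) < d \<longrightarrow>
      (\<Sum>K\<in>D. norm (L (F (Sup K)) - L (F (Inf K)))) < e"
    by blast
qed

lemma absolutely_continuous_on_imp_continuous_on: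
  assumes "absolutely_continuous_on {a..b::real} F"
  shows "continuous_on {a..b} F"
  unfolding continuous_on_iff
proof (intro ballI allI impI)
  fix t e :: real
  assume t: "t \<in> {a..b}" and "e > 0"
  obtain d where d: "d > 0"
    "\<And>D. \<lbrakk>D division_of (\<Union>D); \<Union>D \<subseteq> {a..b}; (\<Sum>K\<in>D. Sup K - Inf K) < d\<rbrakk>
      \<Longrightarrow> (\<Sum>K\<in>D. norm (F (Sup K) - F (Inf K))) < e"
    using absolutely_continuous_onD[OF assms \<open>e > 0\<close>] by blast
  have *: "norm (F s' - F s) < e" if "s \<le> s'" "s \<in> {a..b}" "s' \<in> {a..b}" "s' - s < d" for s s'
    using d(2)[of "{{s..s'}}"] that
    by (auto simp: division_of_def)
  have "dist (F s) (F t) < e" if "s \<in> {a..b}" "dist s t < d" for s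
    using *[of s t] *[of t s] that t
    by (cases "s \<le> t") (auto simp: dist_norm norm_minus_commute)
  with d(1) show "\<exists>d>0. \<forall>s\<in>{a..b}. dist s t < d \<longrightarrow> dist (F s) (F t) < e"
    by blast
qed

text \<open>The interval of a tagged division contains its tag but need not start or end there. The
  linear approximation at \<open>t\<close> with tolerance \<open>D - c\<close> is therefore applied
  to the right and left halves separately, and the two inequalities add up.\<close>

lemma has_vector_derivative_straddle_lower:
  fixes F :: "real \<Rightarrow> real"
  assumes "(F has_vector_derivative D) (at t within I)" "c < D"
  obtains r where "r > 0"
    "\<And>lo hi. \<lbrakk>lo \<in> I; hi \<in> I; lo \<le> t; t \<le> hi; t - lo < r; hi - t < r\<rbrakk>
      \<Longrightarrow> c * (hi - lo) \<le> F hi - F lo"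
proof -
  have "D - c > 0" using assms(2) by simp
  then obtain r where r: "r > 0"
    "\<And>s. \<lbrakk>s \<in> I; norm (s - t) < r\<rbrakk>
      \<Longrightarrow> norm (F s - F t - (s - t) *\<^sub>R D) \<le> (D - c) * norm (s - t)"
    using assms(1) unfolding has_vector_derivative_def has_derivative_within_alt by metis
  have "c * (hi - lo) \<le> F hi - F lo"
    if "lo \<in> I" "hi \<in> I" "lo \<le> t" "t \<le> hi" "t - lo < r" "hi - t < r" for lo hi
  proof -
    have "\<bar>F hi - F t - (hi - t) * D\<bar> \<le> (D - c) * (hi - t)"
      "\<bar>F lo - F t - (lo - t) * D\<bar> \<le> (D - c) * (t - lo)"
      using r(2)[of hi] r(2)[of lo] that by auto
    then have "c * (hi - t) \<le> F hi - F t" "c * (t - lo) \<le> F t - F lo"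
      by (auto simp: abs_le_iff algebra_simps)
    then show ?thesis by (simp add: algebra_simps)
  qed
  with r(1) show ?thesis by (rule that)
qed

(* A fine tagged division exists for every gauge. Away from the exceptional null set the gauge
   exploits differentiability; on it, the intervals are confined to an open set of small measure,
   where absolute continuity bounds the total variation. *)
lemma absolutely_continuous_on_derivative_ge:
  fixes F :: "real \<Rightarrow> real"
  assumes F: "absolutely_continuous_on {a..b} F" and "a \<le> b" and N: "negligible N"
    and deriv: "\<And>t. t \<in> {a..b} - N \<Longrightarrow>
      \<exists>D\<ge>c. (F has_vector_derivative D) (at t within {a..b})"
  shows "c * (b - a) \<le> F b - F a"
proof -
  \<comment> \<open>The error has three sources. Intervals tagged in \<open>N\<close> contribute at
    most \<open>e\<close> through their variation and at most \<open>e\<close> through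
    \<open>\<bar>c\<bar>\<close> times their total length; the remaining intervals contribute at
    most \<open>e\<close> per unit length.\<close>
  have approx: "c * (b - a) \<le> F b - F a + e * (2 + (b - a))" if "e > 0" for e
  proof -
    obtain d where d: "d > 0"
      "\<And>D. \<lbrakk>D division_of (\<Union>D); \<Union>D \<subseteq> {a..b}; (\<Sum>K\<in>D. Sup K - Inf K) < d\<rbrakk>
        \<Longrightarrow> (\<Sum>K\<in>D. norm (F (Sup K) - F (Inf K))) < e"
      using absolutely_continuous_onD[OF F \<open>e > 0\<close>] by blast
    \<comment> \<open>The bound \<open>d\<close> makes absolute continuity applicable to intervals
      of total length below \<open>m\<close>; the other bound keeps \<open>\<bar>c\<bar> * m\<close>
      within \<open>e\<close>, with the added 1 covering \<open>c = 0\<close>.\<close>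
    define m where "m = min d (e / (\<bar>c\<bar> + 1))"
    have m: "m > 0" "m \<le> d" "\<bar>c\<bar> * m \<le> e"
    proof -
      show "m > 0" "m \<le> d" using d(1) \<open>e > 0\<close> by (auto simp: m_def)
      have "(\<bar>c\<bar> + 1) * m \<le> (\<bar>c\<bar> + 1) * (e / (\<bar>c\<bar> + 1))"
        by (intro mult_left_mono) (auto simp: m_def)
      then have "(\<bar>c\<bar> + 1) * m \<le> e" by simp
      with \<open>m > 0\<close> show "\<bar>c\<bar> * m \<le> e" by (simp add: algebra_simps)
    qed
    have "N \<in> sets lebesgue"
      using N by (auto simp: negligible_iff_null_sets)
    obtain W where W: "open W" "N \<subseteq> W" "W \<in> lmeasurable" "measure lebesgue W < m"
    proof -
      obtain W where W: "open W" "N \<subseteq> W" "W - N \<in> lmeasurable" "emeasure lebesgue (W - N) < ennreal m"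
        using sets_lebesgue_outer_open[OF \<open>N \<in> sets lebesgue\<close> m(1)] by metis
      have "W = (W - N) \<union> N" using W(2) by blast
      moreover have "N \<in> lmeasurable" using N by (rule negligible_imp_measurable)
      ultimately have Wm: "W \<in> lmeasurable" using W(3) by (metis fmeasurable.Un)
      have "measure lebesgue W = measure lebesgue (W - N)"
        using N Wm by (simp add: measure_Diff_null_set negligible_iff_null_sets fmeasurableD)
      also have "\<dots> < m"
        using W(3,4) m(1) by (simp add: emeasure_eq_measure2 ennreal_less_iff)
      finally show ?thesis using that W Wm by blast
    qed
    have "\<exists>r>0. (t \<in> N \<longrightarrow> ball t r \<subseteq> W) \<and>
        (t \<in> {a..b} - N \<longrightarrow> (\<forall>lo hi. lo \<in> {a..b} \<and> hi \<in> {a..b} \<and> lo \<le> t \<and> t \<le> hi \<and>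
          t - lo < r \<and> hi - t < r \<longrightarrow> (c - e) * (hi - lo) \<le> F hi - F lo))" for t
    proof (cases "t \<in> N")
      case True
      then show ?thesis using W(1,2) by (metis DiffD2 open_contains_ball subsetD)
    next
      case False
      show ?thesis
      proof (cases "t \<in> {a..b}")
        case True
        then obtain D where D: "D \<ge> c" "(F has_vector_derivative D) (at t within {a..b})"
          using deriv False by blast
        \<comment> \<open>The derivative may equal \<open>c\<close>, while the straddle estimate
          needs a strictly smaller slope; hence \<open>c - e\<close>.\<close>
        obtain r where "r > 0"
          "\<And>lo hi. \<lbrakk>lo \<in> {a..b}; hi \<in> {a..b}; lo \<le> t; t \<le> hi; t - lo < r; hi - t < r\<rbrakk>
            \<Longrightarrow> (c - e) * (hi - lo) \<le> F hi - F lo"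
          using has_vector_derivative_straddle_lower[OF D(2), of "c - e"] D(1) \<open>e > 0\<close> by auto
        then show ?thesis using False by blast
      qed (use False zero_less_one in blast)
    qed
    then obtain r where r: "\<And>t. r t > 0" "\<And>t. t \<in> N \<Longrightarrow> ball t (r t) \<subseteq> W"
      "\<And>t lo hi. \<lbrakk>t \<in> {a..b} - N; lo \<in> {a..b}; hi \<in> {a..b}; lo \<le> t; t \<le> hi;
          t - lo < r t; hi - t < r t\<rbrakk> \<Longrightarrow> (c - e) * (hi - lo) \<le> F hi - F lo"
      by metis
    have "gauge (\<lambda>t. ball t (r t))"
      using r(1) by (simp add: gauge_ball_dependent)
    then obtain P where P: "P tagged_division_of {a..b}" "(\<lambda>t. ball t (r t)) fine P"
      by (rule fine_division_exists_real)
    define dF where "dF K = F (Sup K) - F (Inf K)" for K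
    define len where "len K = Sup K - Inf K" for K :: "real set"
    define Q where "Q = {(t, K) \<in> P. t \<in> N}"
    have "finite P" using P(1) by blast
    have Q: "Q \<subseteq> P" by (auto simp: Q_def)
    have PK: "\<exists>lo hi. K = {lo..hi} \<and> lo \<le> t \<and> t \<le> hi \<and> a \<le> lo \<and> hi \<le> b \<and> t - lo < r t \<and> hi - t < r t"
      if tK: "(t, K) \<in> P" for t K
    proof -
      obtain lo hi where K: "K = {lo..hi}"
        using tagged_division_ofD(4)[OF P(1) tK] by auto
      have t: "lo \<le> t" "t \<le> hi"
        using tagged_division_ofD(2)[OF P(1) tK] K by auto
      have "K \<subseteq> {a..b}" "K \<subseteq> ball t (r t)"
        using tagged_division_ofD(3)[OF P(1) tK] P(2) tK by (auto simp: fine_def)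
      moreover have "lo \<in> K" "hi \<in> K" using K t by auto
      ultimately have "lo \<in> {a..b}" "hi \<in> {a..b}" "lo \<in> ball t (r t)" "hi \<in> ball t (r t)"
        by blast+
      then have "a \<le> lo" "hi \<le> b" "t - lo < r t" "hi - t < r t"
        using t by (auto simp: dist_real_def)
      with K t show ?thesis by blast
    qed
    have len_nonneg: "len K \<ge> 0" if "(t, K) \<in> P" for t K
      using PK[OF that] by (auto simp: len_def)
    have good: "c * len K - e * len K \<le> dF K" if tK: "(t, K) \<in> P - Q" for t K
    proof -
      have "t \<notin> N" using tK by (auto simp: Q_def)
      obtain lo hi where K: "K = {lo..hi}" "lo \<le> t" "t \<le> hi" "a \<le> lo" "hi \<le> b" "t - lo < r t" "hi - t < r t"
        using PK tK by blast
      then show ?thesis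
        using r(3)[of t lo hi] \<open>t \<notin> N\<close> by (simp add: len_def dF_def algebra_simps)
    qed
    have Qpart: "Q tagged_partial_division_of {a..b}"
      using P(1) Q by (metis tagged_division_of_def tagged_partial_division_subset)
    then have Qtag: "Q tagged_division_of \<Union>(snd ` Q)"
      by (rule tagged_partial_division_of_Union_self)
    have Qdiv: "(snd ` Q) division_of \<Union>(snd ` Q)"
      using Qpart by (rule partial_division_of_tagged_division)
    \<comment> \<open>Passing to \<open>snd\<close> may merge pairs with different tags, but only
      when they share a degenerate interval, where \<open>G\<close> vanishes. The library lemma also
      asks for the value 0 at the empty set, where \<open>Sup\<close> and \<open>Inf\<close> carry
      no information; \<open>G'\<close> supplies it, and no tagged interval is empty.\<close>
    have sum_snd: "(\<Sum>(t, K)\<in>Q. G K) = (\<Sum>K\<in>snd ` Q. G K)"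
      if "\<And>s. G {s} = 0" for G :: "real set \<Rightarrow> real"
    proof -
      define G' where "G' K = (if K = {} then 0 else G K)" for K
      have nonempty: "K \<noteq> {}" if "(t, K) \<in> Q" for t K
        using tagged_division_ofD(2)[OF Qtag that] by blast
      have "(\<Sum>(t, K)\<in>Q. G K) = (\<Sum>(t, K)\<in>Q. G' K)"
        using nonempty by (intro sum.cong) (auto simp: G'_def)
      also have "\<dots> = (\<Sum>K\<in>snd ` Q. G' K)"
      proof (rule sum.over_tagged_division_lemma[OF Qtag])
        fix u v :: real assume "box u v = {}"
        then have "u = v \<or> cbox u v = {}" by auto
        then show "G' (cbox u v) = 0" using that by (auto simp: G'_def)
      qed
      also have "\<dots> = (\<Sum>K\<in>snd ` Q. G K)"
        using nonempty by (intro sum.cong) (auto simp: G'_def)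
      finally show ?thesis .
    qed
    have len_sum: "(\<Sum>(t, K)\<in>Q. len K) = (\<Sum>K\<in>snd ` Q. len K)"
      by (rule sum_snd) (simp add: len_def)
    have dF_sum: "(\<Sum>(t, K)\<in>Q. norm (dF K)) = (\<Sum>K\<in>snd ` Q. norm (dF K))"
      by (rule sum_snd) (simp add: dF_def)
    \<comment> \<open>The intervals of a division do not overlap, so their total length is the
      measure of their union, which the gauge confines to \<open>W\<close>.\<close>
    have "(\<Sum>K\<in>snd ` Q. len K) = (\<Sum>K\<in>snd ` Q. measure lebesgue K)"
    proof (rule sum.cong[OF refl])
      fix K assume "K \<in> snd ` Q"
      then obtain t where "(t, K) \<in> P" using Q by auto
      then show "len K = measure lebesgue K"
        using PK[of t K] by (auto simp: len_def)
    qed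
    also have "\<dots> = measure lebesgue (\<Union>(snd ` Q))"
      using content_division[OF Qdiv] .
    also have "\<dots> \<le> measure lebesgue W"
    proof (rule measure_mono_fmeasurable)
      show "\<Union>(snd ` Q) \<subseteq> W"
      proof safe
        fix s t K assume "(t, K) \<in> Q" "s \<in> snd (t, K)"
        moreover from this have "K \<subseteq> ball t (r t)" "t \<in> N"
          using P(2) by (auto simp: Q_def fine_def)
        ultimately show "s \<in> W" using r(2) by auto
      qed
      show "\<Union>(snd ` Q) \<in> sets lebesgue"
        using lmeasurable_division[OF Qdiv] by blast
    qed (rule W(3))
    finally have len_m: "(\<Sum>K\<in>snd ` Q. len K) < m" using W(4) by simp
    have "\<Union>(snd ` Q) \<subseteq> {a..b}"
      using Q tagged_division_ofD(3)[OF P(1)] by force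
    with Qdiv len_m m(2) have "(\<Sum>K\<in>snd ` Q. norm (dF K)) < e"
      using d(2)[of "snd ` Q"] by (simp add: len_def dF_def)
    then have bad_F: "(\<Sum>(t, K)\<in>Q. norm (dF K)) < e" using dF_sum by simp
    have "\<bar>c\<bar> * (\<Sum>(t, K)\<in>Q. len K) \<le> \<bar>c\<bar> * m"
      using len_m len_sum by (intro mult_left_mono) auto
    then have bad_len: "\<bar>c\<bar> * (\<Sum>(t, K)\<in>Q. len K) \<le> e" using m(3) by simp
    have tele: "(\<Sum>(t, K)\<in>P. dF K) = F b - F a" "(\<Sum>(t, K)\<in>P. len K) = b - a"
      using additive_tagged_division_1[OF \<open>a \<le> b\<close> P(1), of F]
        additive_tagged_division_1[OF \<open>a \<le> b\<close> P(1), of "\<lambda>t. t"]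
      by (simp_all add: dF_def len_def)
    have "(\<Sum>(t, K)\<in>P. c * len K - dF K)
        = (\<Sum>(t, K)\<in>Q. c * len K - dF K) + (\<Sum>(t, K)\<in>P - Q. c * len K - dF K)"
      using sum.subset_diff[OF Q \<open>finite P\<close>] by (simp add: add.commute)
    also have "(\<Sum>(t, K)\<in>Q. c * len K - dF K) \<le> (\<Sum>(t, K)\<in>Q. \<bar>c\<bar> * len K + norm (dF K))"
    proof (intro sum_mono, clarify)
      fix t K assume "(t, K) \<in> Q"
      then have "len K \<ge> 0" using len_nonneg Q by blast
      then have "c * len K \<le> \<bar>c\<bar> * len K" by (intro mult_right_mono) auto
      then show "c * len K - dF K \<le> \<bar>c\<bar> * len K + norm (dF K)" by simp
    qed
    also have "\<dots> = \<bar>c\<bar> * (\<Sum>(t, K)\<in>Q. len K) + (\<Sum>(t, K)\<in>Q. norm (dF K))"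
      by (simp add: sum.distrib sum_distrib_left case_prod_unfold)
    also have "(\<Sum>(t, K)\<in>P - Q. c * len K - dF K) \<le> (\<Sum>(t, K)\<in>P - Q. e * len K)"
      using good by (intro sum_mono) (auto simp: algebra_simps)
    also have "\<dots> \<le> (\<Sum>(t, K)\<in>P. e * len K)"
      using len_nonneg \<open>e > 0\<close> \<open>finite P\<close> by (intro sum_mono2) auto
    also have "\<dots> = e * (b - a)"
      using tele(2) by (simp add: sum_distrib_left[symmetric] case_prod_unfold)
    also have "(\<Sum>(t, K)\<in>P. c * len K - dF K) = c * (b - a) - (F b - F a)"
      using tele by (simp add: sum_subtractf sum_distrib_left[symmetric] case_prod_unfold)
    finally show ?thesis using bad_F bad_len by (simp add: algebra_simps)
  qed
  show ?thesis
  proof (rule field_le_epsilon)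
    fix e :: real
    assume "e > 0"
    with approx[of "e / (2 + (b - a))"] \<open>a \<le> b\<close>
    show "c * (b - a) \<le> F b - F a + e" by (simp add: add_pos_nonneg)
  qed
qed

section \<open>Displacement estimates and backward uniqueness for Caratheodory solutions\<close>

lemma AE_lebesgue_on_negligible:
  assumes "AE t in lebesgue_on J. P t" "J \<in> sets lebesgue"
  obtains N where "negligible N" "\<And>t. t \<in> J - N \<Longrightarrow> P t"
proof -
  have "AE t in lebesgue. t \<in> J \<longrightarrow> P t"
    using assms by (simp add: AE_restrict_space_iff)
  then obtain N where "{t \<in> space lebesgue. \<not> (t \<in> J \<longrightarrow> P t)} \<subseteq> N" "N \<in> null_sets lebesgue"
    unfolding eventually_ae_filter by blast
  with that show ?thesis by (auto simp: negligible_iff_null_sets)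
qed

text \<open>The scalar function \<open>q \<bullet> y\<close> is absolutely continuous and has
  derivative \<open>q \<bullet> w t\<close> almost everywhere, so the mean value inequality applies.
  This takes the place of integrating the velocity.\<close>

lemma has_velocity_ae_inner_ge:
  assumes y: "has_velocity_ae y w J" and J: "J \<in> sets lebesgue"
    and ab: "a \<le> b" "{a..b} \<subseteq> J"
    and ge: "AE t in lebesgue_on J. t \<in> {a..b} \<longrightarrow> c \<le> q \<bullet> w t"
  shows "c * (b - a) \<le> q \<bullet> (y b - y a)"
proof -
  have "AE t in lebesgue_on J. (y has_vector_derivative w t) (at t within J)"
    using y by (simp add: has_velocity_ae_def)
  with ge have "AE t in lebesgue_on J. (y has_vector_derivative w t) (at t within J) \<and>
      (t \<in> {a..b} \<longrightarrow> c \<le> q \<bullet> w t)"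
    by eventually_elim simp
  from AE_lebesgue_on_negligible[OF this J] obtain N where N: "negligible N"
    "\<And>t. t \<in> J - N \<Longrightarrow> (y has_vector_derivative w t) (at t within J) \<and>
      (t \<in> {a..b} \<longrightarrow> c \<le> q \<bullet> w t)"
    by metis
  have "c * (b - a) \<le> q \<bullet> y b - q \<bullet> y a"
  proof (rule absolutely_continuous_on_derivative_ge[OF _ ab(1) N(1)])
    show "absolutely_continuous_on {a..b} (\<lambda>t. q \<bullet> y t)"
      using y ab(2) absolutely_continuous_on_bounded_linear[OF _ bounded_linear_inner_right[of q]]
      by (simp add: has_velocity_ae_def)
  next
    fix t assume t: "t \<in> {a..b} - N"
    then have "(y has_vector_derivative w t) (at t within {a..b})" "c \<le> q \<bullet> w t"
      using N(2)[of t] ab(2) has_vector_derivative_within_subset by blast+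
    then show "\<exists>D\<ge>c. ((\<lambda>t. q \<bullet> y t) has_vector_derivative D) (at t within {a..b})"
      using bounded_linear.has_vector_derivative[OF bounded_linear_inner_right] by blast
  qed
  then show ?thesis by (simp add: inner_diff_right)
qed

text \<open>The displacement itself serves as the test direction: by Cauchy-Schwarz its pairing with
  the velocity is at most \<open>norm q * B\<close>, and one factor \<open>norm q\<close> cancels at
  the end.\<close>

lemma has_velocity_ae_norm_le:
  assumes y: "has_velocity_ae y w J" and J: "J \<in> sets lebesgue"
    and ab: "a \<le> b" "{a..b} \<subseteq> J" and "B \<ge> 0"
    and le: "AE t in lebesgue_on J. t \<in> {a..b} \<longrightarrow> norm (w t) \<le> B"
  shows "norm (y b - y a) \<le> B * (b - a)"
proof (cases "y b = y a")
  case False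
  define q where "q = y b - y a"
  have "AE t in lebesgue_on J. t \<in> {a..b} \<longrightarrow> - (norm q * B) \<le> (- q) \<bullet> w t"
    using le
  proof eventually_elim
    case (elim t)
    show ?case
    proof
      assume "t \<in> {a..b}"
      then have "norm q * norm (w t) \<le> norm q * B" using elim by (intro mult_left_mono) auto
      then show "- (norm q * B) \<le> (- q) \<bullet> w t"
        using norm_cauchy_schwarz[of q "w t"] by simp
    qed
  qed
  then have "- (norm q * B) * (b - a) \<le> (- q) \<bullet> (y b - y a)"
    by (rule has_velocity_ae_inner_ge[OF y J ab])
  also have "\<dots> = - (norm q * norm q)"
    by (simp only: q_def[symmetric] inner_minus_left dot_square_norm power2_eq_square)
  finally have "norm q * norm q \<le> norm q * (B * (b - a))" by simp
  with False show ?thesis by (simp add: q_def)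
qed (use assms in simp)

lemma has_velocity_ae_continuous_on:
  assumes "has_velocity_ae y w {a..b}"
  shows "continuous_on {a..b} y"
  using assms by (simp add: has_velocity_ae_def absolutely_continuous_on_imp_continuous_on)

text \<open>A Gronwall-type uniqueness argument run backwards from \<open>T\<close> in steps of
  length \<open>\<eta>\<close>. If \<open>y\<close> vanishes at the right end of a step, its largest
  norm over the step, attained at \<open>s\<close>, is at most half of itself and hence
  zero.\<close>

lemma has_velocity_ae_linear_zero:
  assumes y: "has_velocity_ae y w {0..T}" and "T \<ge> 0" and "y T = 0" and "K \<ge> 0"
    and bound: "AE t in lebesgue_on {0..T}. norm (w t) \<le> K * norm (y t)"
    and t: "t \<in> {0..T}"
  shows "y t = 0"
proof -
  \<comment> \<open>The step length makes the contraction factor \<open>K * \<eta>\<close> at most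
    one half; the added 1 covers \<open>K = 0\<close>.\<close>
  define \<eta> where "\<eta> = 1 / (2 * (K + 1))"
  have \<eta>: "\<eta> > 0" "K * \<eta> \<le> 1 / 2"
    using \<open>K \<ge> 0\<close> by (auto simp: \<eta>_def field_simps)
  have cont: "continuous_on {0..T} y" using y by (rule has_velocity_ae_continuous_on)
  have zero: "\<forall>t\<in>{max 0 (T - real k * \<eta>)..T}. y t = 0" for k
  proof (induction k)
    case 0
    then show ?case using \<open>y T = 0\<close> by auto
  next
    case (Suc k)
    define b where "b = max 0 (T - real k * \<eta>)"
    define a where "a = max 0 (T - real (Suc k) * \<eta>)"
    have ab: "0 \<le> a" "a \<le> b" "b \<le> T" "b - a \<le> \<eta>"
      using \<eta>(1) \<open>T \<ge> 0\<close> by (auto simp: a_def b_def algebra_simps max_def)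
    have "y b = 0" using Suc ab by (auto simp: b_def)
    have "continuous_on {a..b} (\<lambda>t. norm (y t))"
      using cont ab by (intro continuous_on_norm) (auto intro: continuous_on_subset)
    then obtain s where s: "s \<in> {a..b}" "\<And>t. t \<in> {a..b} \<Longrightarrow> norm (y t) \<le> norm (y s)"
      using continuous_attains_sup[of "{a..b}" "\<lambda>t. norm (y t)"] ab(2) by auto
    have "AE t in lebesgue_on {0..T}. t \<in> {s..b} \<longrightarrow> norm (w t) \<le> K * norm (y s)"
      using bound
    proof eventually_elim
      case (elim t)
      show ?case
      proof
        assume "t \<in> {s..b}"
        then have "K * norm (y t) \<le> K * norm (y s)"
          using s \<open>K \<ge> 0\<close> by (intro mult_left_mono) auto
        with elim show "norm (w t) \<le> K * norm (y s)" by simp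
      qed
    qed
    then have "norm (y b - y s) \<le> K * norm (y s) * (b - s)"
      using s(1) ab \<open>K \<ge> 0\<close> by (intro has_velocity_ae_norm_le[OF y]) auto
    also have "\<dots> \<le> K * norm (y s) * \<eta>"
      using s(1) ab \<open>K \<ge> 0\<close> by (intro mult_left_mono) auto
    also have "\<dots> = (K * \<eta>) * norm (y s)" by simp
    also have "\<dots> \<le> (1 / 2) * norm (y s)" by (intro mult_right_mono \<eta>(2)) simp
    finally have "norm (y s) = 0" using \<open>y b = 0\<close> by simp
    then have "\<forall>t\<in>{a..b}. y t = 0" using s(2) by force
    moreover have "\<forall>t\<in>{b..T}. y t = 0" using Suc by (simp add: b_def)
    ultimately have "\<forall>t\<in>{a..T}. y t = 0" by force
    then show ?case by (simp add: a_def)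
  qed
  obtain k where "T / \<eta> \<le> real k" using real_arch_simple by blast
  then have "T - real k * \<eta> \<le> 0" using \<eta>(1) by (simp add: field_simps)
  with zero[of k] t show ?thesis by auto
qed

lemma has_velocity_ae_scaleR:
  assumes "has_velocity_ae y w J"
  shows "has_velocity_ae (\<lambda>t. c *\<^sub>R y t) (\<lambda>t. c *\<^sub>R w t) J"
proof -
  have "AE t in lebesgue_on J. ((\<lambda>t. c *\<^sub>R y t) has_vector_derivative c *\<^sub>R w t) (at t within J)"
    using assms unfolding has_velocity_ae_def
    using bounded_linear.has_vector_derivative[OF bounded_linear_scaleR_right[of c]]
    by (auto elim!: eventually_mono)
  then show ?thesis
    using assms absolutely_continuous_on_bounded_linear[OF _ bounded_linear_scaleR_right[of c]]
    unfolding has_velocity_ae_def by blast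
qed

subsection \<open>Velocity bounds\<close>

text \<open>Difference quotients in direction \<open>v\<close> are bounded by
  \<open>L * norm v\<close>, and short ones differ from \<open>F' v\<close> by at most
  \<open>e * norm v\<close>.\<close>

lemma lipschitz_on_has_derivative_norm_le:
  assumes L: "L-lipschitz_on UNIV F" and F: "(F has_derivative F') (at z)"
  shows "norm (F' v) \<le> L * norm v"
proof -
  have approx: "norm (F' v) \<le> L * norm v + e * norm v" if "e > 0" for e
  proof -
    obtain d where d: "d > 0"
      "\<And>y. norm (y - z) < d \<Longrightarrow> norm (F y - F z - F' (y - z)) \<le> e * norm (y - z)"
      using F \<open>e > 0\<close> unfolding has_derivative_at_alt by metis
    define s where "s = d / (norm v + 1)"
    have s: "s > 0" "s * norm v < d"
    proof -
      show "s > 0" using d(1) by (simp add: s_def add_nonneg_pos)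
      then have "s * norm v < s * (norm v + 1)" by simp
      also have "\<dots> = d" by (simp add: s_def add_nonneg_eq_0_iff)
      finally show "s * norm v < d" .
    qed
    have "s * norm (F' v) = norm (F' (s *\<^sub>R v))"
      using s(1) F by (simp add: linear_scale has_derivative_linear)
    also have "\<dots> \<le> norm (F (z + s *\<^sub>R v) - F z) + norm (F (z + s *\<^sub>R v) - F z - F' (s *\<^sub>R v))"
      using norm_triangle_ineq4[of "F (z + s *\<^sub>R v) - F z" "F (z + s *\<^sub>R v) - F z - F' (s *\<^sub>R v)"]
      by simp
    also have "\<dots> \<le> L * (s * norm v) + e * (s * norm v)"
      using lipschitz_onD[OF L, of "z + s *\<^sub>R v" z] d(2)[of "z + s *\<^sub>R v"] s
      by (intro add_mono) (auto simp: dist_norm)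
    also have "\<dots> = s * (L * norm v + e * norm v)" by (simp add: algebra_simps)
    finally show ?thesis using s(1) by simp
  qed
  show ?thesis
  proof (rule field_le_epsilon)
    fix e :: real
    assume "e > 0"
    then have "e / (norm v + 1) > 0" by (simp add: add_nonneg_pos)
    from approx[OF this] have "norm (F' v) \<le> L * norm v + e * (norm v / (norm v + 1))" by simp
    also have "\<dots> \<le> L * norm v + e * 1"
      using \<open>e > 0\<close> by (intro add_left_mono mult_left_mono) (auto simp: divide_le_eq add_nonneg_pos)
    finally show "norm (F' v) \<le> L * norm v + e" by simp
  qed
qed

lemma bounded_bilinear_matrix_vector_mult:
  "bounded_bilinear ((*v) :: real^'m^'n \<Rightarrow> real^'m \<Rightarrow> real^'n)"
  unfolding bilinear_conv_bounded_bilinear[symmetric] bilinear_def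
  by (auto intro!: linearI simp: matrix_vector_mult_add_rdistrib matrix_vector_right_distrib
      scaleR_matrix_vector_assoc matrix_vector_mult_scaleR)

lemma norm_jacobian_le:
  fixes F :: "real^'n \<Rightarrow> real^'k"
  assumes "L-lipschitz_on UNIV F" "F differentiable at z"
  shows "norm (jacobian F (at z) *v v) \<le> L * norm v"
  using assms lipschitz_on_has_derivative_norm_le jacobian_works by blast

text \<open>Pairing \<open>transpose A *v v\<close> with itself and moving the transpose across the
  inner product leaves \<open>A\<close> applied to that same vector, where the hypothesis applies;
  one factor of its norm then cancels.\<close>

lemma norm_transpose_le:
  fixes A :: "real^'m^'n"
  assumes A: "\<And>v. norm (A *v v) \<le> K * norm v"
  shows "norm (transpose A *v v) \<le> K * norm v"
proof (cases "transpose A *v v = 0")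
  case True
  \<comment> \<open>The sign of \<open>K\<close> is not given; testing the hypothesis on a unit
    vector shows that it is nonnegative.\<close>
  have "0 \<le> K * norm (axis undefined 1 :: real^'m)"
    by (rule order_trans[OF norm_ge_zero A])
  with True show ?thesis by simp
next
  case False
  let ?w = "transpose A *v v"
  have "norm ?w * norm ?w = ?w \<bullet> ?w" by (simp add: dot_square_norm power2_eq_square)
  also have "\<dots> = v \<bullet> (A *v ?w)"
    by (metis dot_lmul_matrix transpose_transpose vector_transpose_matrix)
  also have "\<dots> \<le> norm v * norm (A *v ?w)" by (rule norm_cauchy_schwarz)
  also have "\<dots> \<le> norm v * (K * norm ?w)" by (intro mult_left_mono A) simp
  finally show ?thesis using False by (simp add: mult.commute[of K])
qed

text \<open>This makes the costate equation linear with bounded coefficients, as backward uniqueness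
  requires. Global Lipschitz constants bound the Jacobians uniformly in \<open>z\<close>, and a
  bound on \<open>v\<close> gives \<open>\<lambda>y. g y *v v\<close> a Lipschitz constant
  independent of \<open>v\<close>.\<close>

lemma costate_velocity_bound:
  fixes f :: "real^'n \<Rightarrow> real^'n" and g :: "real^'n \<Rightarrow> real^'m^'n"
  assumes f: "lipschitz_with_lipschitz_derivative f"
    and g: "lipschitz_with_lipschitz_derivative g" and "B \<ge> 0"
  obtains K where "K \<ge> 0"
    "\<And>z v p. norm v \<le> B \<Longrightarrow>
      norm (transpose (jacobian f (at z) + jacobian (\<lambda>y. g y *v v) (at z)) *v p) \<le> K * norm p"
proof -
  obtain Lf Lg where L: "Lf-lipschitz_on UNIV f" "Lg-lipschitz_on UNIV g"
    using f g unfolding lipschitz_with_lipschitz_derivative_def by blast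
  have nonneg: "Lf \<ge> 0" "Lg \<ge> 0" using L by (auto simp: lipschitz_on_def)
  have diff: "f differentiable at z" "g differentiable at z" for z
    using f g unfolding lipschitz_with_lipschitz_derivative_def by blast+
  interpret mv: bounded_bilinear "(*v) :: real^'m^'n \<Rightarrow> real^'m \<Rightarrow> real^'n"
    by (rule bounded_bilinear_matrix_vector_mult)
  obtain C where C: "C \<ge> 0" "\<And>A v. norm (A *v v :: real^'n) \<le> norm A * norm (v :: real^'m) * C"
    using mv.nonneg_bounded by blast
  let ?K = "Lf + Lg * B * C"
  show ?thesis
  proof (rule that)
    show "?K \<ge> 0" using nonneg C(1) \<open>B \<ge> 0\<close> by simp
  next
    fix z p :: "real^'n" and v :: "real^'m"
    assume v: "norm v \<le> B"
    have lip: "(Lg * B * C)-lipschitz_on UNIV (\<lambda>y. g y *v v)"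
    proof (rule lipschitz_onI)
      fix y y' :: "real^'n"
      have "norm (g y *v v - g y' *v v) = norm ((g y - g y') *v v)" by (simp add: mv.diff_left)
      also have "\<dots> \<le> norm (g y - g y') * norm v * C" by (rule C(2))
      also have "\<dots> \<le> (Lg * dist y y') * B * C"
        using lipschitz_onD[OF L(2), of y y'] v nonneg C(1)
        by (intro mult_right_mono mult_mono) (auto simp: dist_norm)
      finally show "dist (g y *v v) (g y' *v v) \<le> Lg * B * C * dist y y'"
        by (simp add: dist_norm algebra_simps)
    qed (use nonneg C(1) \<open>B \<ge> 0\<close> in simp)
    have "bounded_linear (\<lambda>A :: real^'m^'n. A *v v)" by (rule mv.bounded_linear_left)
    then have "(\<lambda>y. g y *v v) differentiable at z"
      using diff(2)[of z] bounded_linear.has_derivative unfolding differentiable_def by blast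
    note J = norm_jacobian_le[OF L(1) diff(1)[of z]] norm_jacobian_le[OF lip this]
    show "norm (transpose (jacobian f (at z) + jacobian (\<lambda>y. g y *v v) (at z)) *v p) \<le> ?K * norm p"
    proof (rule norm_transpose_le)
      fix \<xi> :: "real^'n"
      show "norm ((jacobian f (at z) + jacobian (\<lambda>y. g y *v v) (at z)) *v \<xi>) \<le> ?K * norm \<xi>"
        using norm_triangle_mono[OF J(1)[of \<xi>] J(2)[of \<xi>]]
        by (simp add: matrix_vector_mult_add_rdistrib distrib_right)
    qed
  qed
qed

lemma continuous_on_matrix_vector_mult [continuous_intros]:
  fixes A :: "'a::topological_space \<Rightarrow> real^'m^'n" and v :: "'a \<Rightarrow> real^'m"
  assumes "continuous_on I A" "continuous_on I v"
  shows "continuous_on I (\<lambda>t. A t *v v t)"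
  using bounded_bilinear.continuous_on[OF bounded_bilinear_matrix_vector_mult assms] .

lemma lipschitz_with_lipschitz_derivative_continuous_on:
  assumes "lipschitz_with_lipschitz_derivative F" "continuous_on I y"
  shows "continuous_on I (\<lambda>t. F (y t))"
proof -
  have "continuous_on UNIV F"
    using assms(1) lipschitz_on_continuous_on
    unfolding lipschitz_with_lipschitz_derivative_def by blast
  then show ?thesis using assms(2) by (rule continuous_on_compose2) simp
qed

text \<open>On the compact time interval \<open>f\<close> and \<open>g\<close> are bounded along the
  continuous curve, so bounded control values give bounded velocities.\<close>

lemma control_affine_velocity_bound:
  fixes f :: "real^'n \<Rightarrow> real^'n" and g :: "real^'n \<Rightarrow> real^'m^'n"
  assumes f: "lipschitz_with_lipschitz_derivative f"
    and g: "lipschitz_with_lipschitz_derivative g"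
    and x: "continuous_on {0..T::real} x" and "B \<ge> 0"
  obtains W where "W \<ge> 0"
    "\<And>t v. \<lbrakk>t \<in> {0..T}; norm v \<le> B\<rbrakk> \<Longrightarrow> norm (f (x t) + g (x t) *v v) \<le> W"
proof -
  obtain C where C: "C \<ge> 0" "\<And>A v. norm (A *v v :: real^'n) \<le> norm (A :: real^'m^'n) * norm v * C"
    using bounded_bilinear.nonneg_bounded[OF bounded_bilinear_matrix_vector_mult] by blast
  have "bounded ((\<lambda>t. f (x t)) ` {0..T})" "bounded ((\<lambda>t. g (x t)) ` {0..T})"
    using f g x by (simp_all add: compact_imp_bounded compact_continuous_image
        lipschitz_with_lipschitz_derivative_continuous_on)
  then obtain M N where M: "M > 0" "\<And>t. t \<in> {0..T} \<Longrightarrow> norm (f (x t)) \<le> M"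
    and N: "N > 0" "\<And>t. t \<in> {0..T} \<Longrightarrow> norm (g (x t)) \<le> N"
    unfolding bounded_pos by blast
  show ?thesis
  proof (rule that)
    show "M + N * B * C \<ge> 0" using M(1) N(1) \<open>B \<ge> 0\<close> C(1) by simp
  next
    fix t and v :: "real^'m"
    assume tv: "t \<in> {0..T}" "norm v \<le> B"
    have "norm (g (x t) *v v) \<le> norm (g (x t)) * norm v * C" by (rule C(2))
    also have "\<dots> \<le> N * B * C"
      using N(1) N(2)[OF tv(1)] tv(2) C(1) by (intro mult_right_mono mult_mono) auto
    finally show "norm (f (x t) + g (x t) *v v) \<le> M + N * B * C"
      by (rule norm_triangle_mono[OF M(2)[OF tv(1)]])
  qed
qed

subsection \<open>Curves ending on the boundary of a superlevel set\<close>

text \<open>The first-order decrease \<open>\<delta> * \<tau>\<close> beats the remainder, which is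
  at most \<open>e * B * \<tau>\<close>. Since \<open>v\<close> is only bounded by a multiple of
  \<open>\<tau>\<close>, one threshold serves all displacements, forward or backward in
  time.\<close>

lemma GDERIV_negative_nearby:
  assumes h: "GDERIV h z :> q" and "h z = 0" and "\<delta> > 0" and "B \<ge> 0"
  obtains \<tau>0 where "\<tau>0 > 0"
    "\<And>\<tau> v. \<lbrakk>0 < \<tau>; \<tau> < \<tau>0; norm v \<le> B * \<tau>; q \<bullet> v \<le> - (\<delta> * \<tau>)\<rbrakk> \<Longrightarrow> h (z + v) < 0"
proof -
  define e where "e = \<delta> / (2 * (B + 1))"
  have e: "e > 0" "e * B < \<delta>"
    using assms(3,4) by (auto simp: e_def field_simps intro: add_nonneg_pos)
  obtain d where d: "d > 0"
    "\<And>y. norm (y - z) < d \<Longrightarrow> norm (h y - h z - (y - z) \<bullet> q) \<le> e * norm (y - z)"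
    using h e(1) unfolding gderiv_def has_derivative_at_alt by metis
  show ?thesis
  proof (rule that)
    show "d / (B + 1) > 0" using d(1) assms(4) by simp
  next
    fix \<tau> v
    assume \<tau>: "0 < \<tau>" "\<tau> < d / (B + 1)" and v: "norm v \<le> B * \<tau>" "q \<bullet> v \<le> - (\<delta> * \<tau>)"
    have "\<tau> * (B + 1) < d" using \<tau>(2) assms(4) by (simp add: field_simps)
    then have "norm v < d" using v(1) \<tau>(1) by (simp add: algebra_simps)
    then have "\<bar>h (z + v) - v \<bullet> q\<bar> \<le> e * norm v"
      using d(2)[of "z + v"] \<open>h z = 0\<close> by simp
    also have "\<dots> \<le> e * (B * \<tau>)" using v(1) e(1) by (intro mult_left_mono) auto
    also have "\<dots> < \<delta> * \<tau>" using e(2) \<tau>(1) by simp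
    finally show "h (z + v) < 0" using v(2) by (simp add: inner_commute abs_less_iff)
  qed
qed

text \<open>The superlevel set is closed, and the open set where \<open>h\<close> is positive lies
  in its interior. Equality may fail, for instance at an interior local minimum of \<open>h\<close>
  with value zero.\<close>

lemma frontier_superlevel_subset:
  fixes h :: "'a::euclidean_space \<Rightarrow> real"
  assumes "continuous_on UNIV h"
  shows "frontier {y. h y \<ge> 0} \<subseteq> {y. h y = 0}"
proof -
  have "closed {y. h y \<ge> 0}" "open {y. h y > 0}"
    using assms by (auto intro: closed_Collect_le open_Collect_less continuous_on_const)
  moreover have "{y. h y > 0} \<subseteq> {y. h y \<ge> 0}" by auto
  ultimately have "frontier {y. h y \<ge> 0} \<subseteq> {y. h y \<ge> 0} - {y. h y > 0}"
    unfolding frontier_def by (auto dest: interior_maximal)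
  then show ?thesis by auto
qed

text \<open>Along a curve in the frontier \<open>h\<close> is constantly zero, so the chain rule
  makes the initial velocity orthogonal to the gradient.\<close>

lemma tangent_space_frontier_subset:
  assumes h: "GDERIV h z :> q" and cont: "continuous_on UNIV h"
  shows "tangent_space (frontier {y. h y \<ge> 0}) z \<subseteq> {v. q \<bullet> v = 0}"
proof
  fix v assume "v \<in> tangent_space (frontier {y. h y \<ge> 0}) z"
  then obtain c e where c: "e > 0" "c ` {-e<..<e} \<subseteq> frontier {y. h y \<ge> 0}"
    "c 0 = z" "(c has_vector_derivative v) (at 0)"
    unfolding tangent_space_def by blast
  have zero: "h (c s) = 0" if "s \<in> {-e<..<e}" for s
    using frontier_superlevel_subset[OF cont] c(2) that by blast
  have "((\<lambda>s. h (c s)) has_vector_derivative v \<bullet> q) (at 0)"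
    using has_derivative_compose[of c "\<lambda>s. s *\<^sub>R v" 0 UNIV h "\<lambda>v. v \<bullet> q"] c h
    by (simp add: gderiv_def has_vector_derivative_def)
  moreover have "((\<lambda>s. h (c s)) has_vector_derivative 0) (at 0)"
    by (rule has_vector_derivative_transform_within_open[where f = "\<lambda>_. 0" and S = "{-e<..<e}"])
      (use zero c(1) in auto)
  ultimately have "v \<bullet> q = 0" by (rule vector_derivative_unique_at)
  then show "v \<in> {v. q \<bullet> v = 0}" by (simp add: inner_commute)
qed

text \<open>The set \<open>V\<close> is not assumed to be a subspace, but the dimension count forces
  its span to be the whole hyperplane. The part \<open>r\<close> of \<open>p\<close> orthogonal to
  \<open>q\<close> then lies in that span, to which \<open>p\<close> is orthogonal, so
  \<open>r\<close> is zero.\<close>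

lemma orthogonal_to_codim1_parallel:
  fixes p q :: "'a::euclidean_space"
  assumes "q \<noteq> 0" and V: "V \<subseteq> {v. q \<bullet> v = 0}" "dim V = DIM('a) - 1"
    and p: "\<And>v. v \<in> V \<Longrightarrow> orthogonal p v"
  obtains c where "p = c *\<^sub>R q"
proof -
  let ?H = "{v. q \<bullet> v = 0}"
  have H: "span V = ?H"
  proof (rule subspace_dim_equal)
    show "subspace ?H" by (rule subspace_hyperplane)
    then show "span V \<subseteq> ?H" using V(1) by (simp add: span_minimal)
    show "dim ?H \<le> dim (span V)"
      using V(2) dim_hyperplane[OF \<open>q \<noteq> 0\<close>] by (simp add: dim_span)
  qed (rule subspace_span)
  define r where "r = p - (p \<bullet> q / (q \<bullet> q)) *\<^sub>R q"
  have "q \<bullet> r = 0" using \<open>q \<noteq> 0\<close> by (simp add: r_def inner_diff_right inner_commute)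
  then have "r \<in> span V" using H by blast
  then have "p \<bullet> r = 0" using p orthogonal_to_span[of r V p] by (auto simp: orthogonal_def)
  then have "r \<bullet> r = 0"
    using \<open>q \<bullet> r = 0\<close> by (subst r_def) (simp add: inner_diff_left)
  then have "p = (p \<bullet> q / (q \<bullet> q)) *\<^sub>R q" by (simp add: r_def)
  with that show ?thesis by blast
qed

text \<open>An outward velocity at \<open>T\<close> would stay outward shortly afterwards, and the
  accumulated displacement would make \<open>h\<close> negative. Continuity of \<open>w\<close> is
  what ties the single value \<open>w T\<close> to an equation holding only almost
  everywhere.\<close>

lemma inward_velocity_right:
  assumes y: "has_velocity_ae y w J" and J: "J \<in> sets lebesgue"
    and "e > 0" and sub: "{T..<T + e} \<subseteq> J" and w: "continuous_on {T..<T + e} w"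
    and h: "GDERIV h (y T) :> q" "h (y T) = 0"
    and safe: "\<And>t. t \<in> {T..<T + e} \<Longrightarrow> h (y t) \<ge> 0"
  shows "q \<bullet> w T \<ge> 0"
proof (rule ccontr)
  assume "\<not> q \<bullet> w T \<ge> 0"
  define \<delta> where "\<delta> = - (q \<bullet> w T) / 2"
  define B where "B = norm (w T) + 1"
  have "\<delta> > 0" using \<open>\<not> q \<bullet> w T \<ge> 0\<close> by (simp add: \<delta>_def)
  have "B \<ge> 0" by (simp add: B_def)
  have "(w \<longlongrightarrow> w T) (at T within {T..<T + e})"
    using w \<open>e > 0\<close> by (simp add: continuous_on)
  then have lim: "((\<lambda>t. q \<bullet> w t) \<longlongrightarrow> q \<bullet> w T) (at T within {T..<T + e})"
    "((\<lambda>t. norm (w t)) \<longlongrightarrow> norm (w T)) (at T within {T..<T + e})"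
    by (auto intro: tendsto_intros)
  have lt: "q \<bullet> w T < - \<delta>" "norm (w T) < B"
    using \<open>\<delta> > 0\<close> by (auto simp: \<delta>_def B_def)
  from order_tendstoD(2)[OF lim(1) lt(1)] order_tendstoD(2)[OF lim(2) lt(2)]
  have "\<forall>\<^sub>F t in at T within {T..<T + e}. q \<bullet> w t < - \<delta> \<and> norm (w t) < B"
    by (rule eventually_conj)
  then obtain d where d: "d > 0"
    "\<And>t. \<lbrakk>t \<in> {T..<T + e}; t \<noteq> T; dist t T < d\<rbrakk> \<Longrightarrow> q \<bullet> w t < - \<delta> \<and> norm (w t) < B"
    unfolding eventually_at by blast
  \<comment> \<open>The limit says nothing about \<open>t = T\<close> itself; there both bounds hold
    by the choice of \<open>\<delta>\<close> and \<open>B\<close>.\<close>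
  have near: "q \<bullet> w t \<le> - \<delta>" "norm (w t) \<le> B" if "t \<in> {T..<T + e}" "t < T + d" for t
    using d(2)[of t] that \<open>\<delta> > 0\<close> by (cases "t = T"; force simp: dist_real_def \<delta>_def B_def)+
  obtain \<tau>0 where \<tau>0: "\<tau>0 > 0"
    "\<And>\<tau> v. \<lbrakk>0 < \<tau>; \<tau> < \<tau>0; norm v \<le> B * \<tau>; q \<bullet> v \<le> - (\<delta> * \<tau>)\<rbrakk> \<Longrightarrow> h (y T + v) < 0"
    using GDERIV_negative_nearby[OF h \<open>\<delta> > 0\<close> \<open>B \<ge> 0\<close>] by blast
  define \<tau> where "\<tau> = min (min d e) \<tau>0 / 2"
  have \<tau>: "0 < \<tau>" "\<tau> < d" "\<tau> < e" "\<tau> < \<tau>0"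
    using d(1) \<open>e > 0\<close> \<tau>0(1) by (auto simp: \<tau>_def)
  have inside: "{T..T + \<tau>} \<subseteq> J" "T \<le> T + \<tau>" using sub \<tau> by auto
  have "AE t in lebesgue_on J. t \<in> {T..T + \<tau>} \<longrightarrow> \<delta> \<le> (- q) \<bullet> w t"
    "AE t in lebesgue_on J. t \<in> {T..T + \<tau>} \<longrightarrow> norm (w t) \<le> B"
    using near \<tau> by (intro AE_I2; force)+
  then have "\<delta> * \<tau> \<le> (- q) \<bullet> (y (T + \<tau>) - y T)" "norm (y (T + \<tau>) - y T) \<le> B * \<tau>"
    using has_velocity_ae_inner_ge[OF y J inside(2,1)]
      has_velocity_ae_norm_le[OF y J inside(2,1) \<open>B \<ge> 0\<close>] by fastforce+
  then have "h (y T + (y (T + \<tau>) - y T)) < 0" using \<tau> by (intro \<tau>0(2)[of \<tau>]) auto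
  moreover have "h (y (T + \<tau>)) \<ge> 0" using \<tau> by (intro safe) auto
  ultimately show False by simp
qed

text \<open>The mirror image before \<open>T\<close>: going back from \<open>T\<close> produces a
  displacement against \<open>q\<close>. The control need not be continuous on this side, so the
  ascent is assumed almost everywhere near \<open>T\<close> instead of being derived from the value
  at \<open>T\<close>.\<close>

lemma no_uniform_ascent_left:
  assumes y: "has_velocity_ae y w {0..T}" and "T > 0" and "B \<ge> 0"
    and bound: "AE t in lebesgue_on {0..T}. norm (w t) \<le> B"
    and "\<eta> > 0" "\<delta> > 0"
    and ascent: "AE t in lebesgue_on {0..T}. T - \<eta> < t \<longrightarrow> \<delta> \<le> q \<bullet> w t"
    and h: "GDERIV h (y T) :> q" "h (y T) = 0"
    and safe: "\<And>t. t \<in> {0..T} \<Longrightarrow> h (y t) \<ge> 0"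
  shows False
proof -
  obtain \<tau>0 where \<tau>0: "\<tau>0 > 0"
    "\<And>\<tau> v. \<lbrakk>0 < \<tau>; \<tau> < \<tau>0; norm v \<le> B * \<tau>; q \<bullet> v \<le> - (\<delta> * \<tau>)\<rbrakk> \<Longrightarrow> h (y T + v) < 0"
    using GDERIV_negative_nearby[OF h \<open>\<delta> > 0\<close> \<open>B \<ge> 0\<close>] by blast
  define \<tau> where "\<tau> = min (min \<eta> T) \<tau>0 / 2"
  have \<tau>: "0 < \<tau>" "\<tau> < \<eta>" "\<tau> < T" "\<tau> < \<tau>0"
    using \<open>\<eta> > 0\<close> \<open>T > 0\<close> \<tau>0(1) by (auto simp: \<tau>_def)
  have inside: "{T - \<tau>..T} \<subseteq> {0..T}" "T - \<tau> \<le> T" using \<tau> by auto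
  have J: "{0..T} \<in> sets lebesgue" by simp
  have "AE t in lebesgue_on {0..T}. t \<in> {T - \<tau>..T} \<longrightarrow> \<delta> \<le> q \<bullet> w t"
    using ascent by eventually_elim (use \<tau> in auto)
  from has_velocity_ae_inner_ge[OF y J inside(2,1) this]
  have "\<delta> * \<tau> \<le> q \<bullet> (y T - y (T - \<tau>))" by simp
  moreover have "AE t in lebesgue_on {0..T}. t \<in> {T - \<tau>..T} \<longrightarrow> norm (w t) \<le> B"
    using bound by eventually_elim simp
  from has_velocity_ae_norm_le[OF y J inside(2,1) \<open>B \<ge> 0\<close> this]
  have "norm (y (T - \<tau>) - y T) \<le> B * \<tau>" by (simp add: norm_minus_commute)
  ultimately have "h (y T + (y (T - \<tau>) - y T)) < 0"
    using \<tau> by (intro \<tau>0(2)[of \<tau>]) (auto simp: inner_diff_right)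
  moreover have "h (y (T - \<tau>)) \<ge> 0" using \<tau> by (intro safe) auto
  ultimately show False by simp
qed

subsection \<open>Transversality\<close>

text \<open>Smoothness enters as right continuity of the extended control at \<open>T\<close>, with
  value \<open>u T\<close>, so the velocity of the extension is continuous from \<open>T\<close>
  on.\<close>

lemma safe_extension_final_velocity:
  fixes f :: "real^'n \<Rightarrow> real^'n" and g :: "real^'n \<Rightarrow> real^'m^'n"
  assumes f: "lipschitz_with_lipschitz_derivative f"
    and g: "lipschitz_with_lipschitz_derivative g"
    and "T > 0" "e > 0"
    and ext: "smooth_safe_extension f g U {y. h y \<ge> 0} T x u e x' u'"
    and h: "GDERIV h (x T) :> q" "h (x T) = 0"
  shows "q \<bullet> (f (x T) + g (x T) *v u T) \<ge> 0"
proof -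
  have T: "x' T = x T" "u' T = u T"
    using ext \<open>T > 0\<close> by (auto simp: smooth_safe_extension_def)
  have x': "has_velocity_ae x' (\<lambda>t. f (x' t) + g (x' t) *v u' t) {0..<T + e}"
    using ext by (simp add: smooth_safe_extension_def state_trajectory_def)
  \<comment> \<open>The extension lives on a half-open interval and is absolutely continuous only on
    compact subintervals, hence the restriction to half the extension length.\<close>
  have "absolutely_continuous_on {0..T + e / 2} x'"
    using x' \<open>e > 0\<close> unfolding has_velocity_ae_def by (simp add: subset_iff)
  then have x'_cont: "continuous_on {T..<T + e / 2} x'"
    using \<open>T > 0\<close> by (intro continuous_on_subset[OF absolutely_continuous_on_imp_continuous_on]) auto
  obtain D where D: "\<And>t. t \<in> {T..<T + e} \<Longrightarrow> D 0 t = u' t"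
    "\<And>k t. t \<in> {T..<T + e} \<Longrightarrow> (D k has_vector_derivative D (Suc k) t) (at t within {T..<T + e})"
    using ext unfolding smooth_safe_extension_def smooth_on_interval_def by metis
  have "continuous_on {T..<T + e} (D 0)"
    using D(2) by (intro continuous_on_vector_derivative)
  then have "continuous_on {T..<T + e} u'"
    using D(1) continuous_on_cong[OF refl, of "{T..<T + e}" "D 0" u'] by blast
  then have "continuous_on {T..<T + e / 2} u'"
    by (rule continuous_on_subset) (use \<open>e > 0\<close> in auto)
  then have "continuous_on {T..<T + e / 2} (\<lambda>t. f (x' t) + g (x' t) *v u' t)"
    by (intro continuous_intros lipschitz_with_lipschitz_derivative_continuous_on[OF f x'_cont]
        lipschitz_with_lipschitz_derivative_continuous_on[OF g x'_cont])
  moreover have "h (x' t) \<ge> 0" if "t \<in> {T..<T + e / 2}" for t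
    using ext that \<open>T > 0\<close> \<open>e > 0\<close> by (auto simp: smooth_safe_extension_def)
  ultimately have "q \<bullet> (f (x' T) + g (x' T) *v u' T) \<ge> 0"
    using h \<open>T > 0\<close> \<open>e > 0\<close> T
    by (intro inward_velocity_right[OF x', where e = "e / 2" and h = h]) auto
  then show ?thesis using T by simp
qed

(* The value of u at the single time T need not be the limit of the velocities before T, so it is
   compared with u t through the maximum condition, tested against the competitor u T. *)
lemma maximizing_control_final_pairing_nonpos:
  fixes f :: "real^'n \<Rightarrow> real^'n" and g :: "real^'n \<Rightarrow> real^'m^'n"
  assumes f: "lipschitz_with_lipschitz_derivative f"
    and g: "lipschitz_with_lipschitz_derivative g" and "T > 0"
    and u: "admissible_control U T u" and x: "state_trajectory f g u {0..T} x"
    and p: "continuous_on {0..T} p" and max: "maximizing_control g U u x {0..T} p"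
    and h: "GDERIV h (x T) :> q" "h (x T) = 0"
    and safe: "\<And>t. t \<in> {0..T} \<Longrightarrow> h (x t) \<ge> 0"
    and pT: "p T = c *\<^sub>R q" "c > 0"
  shows "p T \<bullet> (f (x T) + g (x T) *v u T) \<le> 0"
proof (rule ccontr)
  assume neg: "\<not> ?thesis"
  define w where "w t = f (x t) + g (x t) *v u t" for t
  define a where "a = (p T \<bullet> w T) / 2"
  have "a > 0" using neg by (simp add: a_def w_def)
  have x_vel: "has_velocity_ae x w {0..T}"
    using x by (simp add: state_trajectory_def w_def[abs_def])
  then have x_cont: "continuous_on {0..T} x" by (rule has_velocity_ae_continuous_on)
  obtain B0 where B0: "AE t in lebesgue_on {0..T}. norm (u t) \<le> B0"
    using u unfolding admissible_control_def by blast
  obtain W where W: "W \<ge> 0"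
    "\<And>t v. \<lbrakk>t \<in> {0..T}; norm v \<le> max B0 0\<rbrakk> \<Longrightarrow> norm (f (x t) + g (x t) *v v) \<le> W"
    by (rule control_affine_velocity_bound[OF f g x_cont, of "max B0 0"]) auto
  have inside: "AE t in lebesgue_on {0..T}. t \<in> {0..T}" by (rule AE_I2) simp
  with B0 have bound: "AE t in lebesgue_on {0..T}. norm (w t) \<le> W"
    by eventually_elim (auto simp: w_def intro!: W(2))
  \<comment> \<open>A continuous function bounding \<open>p T \<bullet> w t\<close> from below for
    almost every \<open>t\<close>. The first term uses the fixed competitor \<open>u T\<close>; the
    second pays for replacing \<open>p t\<close> by \<open>p T\<close> and vanishes at
    \<open>T\<close>, where the value is \<open>2 * a\<close>. Near \<open>T\<close> it therefore
    exceeds \<open>a\<close>.\<close>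
  define \<psi> where "\<psi> t = p t \<bullet> (f (x t) + g (x t) *v u T) - norm (p T - p t) * W" for t
  have "continuous_on {0..T} \<psi>"
    unfolding \<psi>_def
    by (intro continuous_intros lipschitz_with_lipschitz_derivative_continuous_on[OF f x_cont]
        lipschitz_with_lipschitz_derivative_continuous_on[OF g x_cont] p)
  moreover have "T \<in> {0..T}" using \<open>T > 0\<close> by simp
  ultimately have "\<exists>\<eta>>0. \<forall>t\<in>{0..T}. dist t T < \<eta> \<longrightarrow> dist (\<psi> t) (\<psi> T) < a"
    using \<open>a > 0\<close> unfolding continuous_on_iff by blast
  moreover have "\<psi> T = 2 * a" by (simp add: \<psi>_def a_def w_def)
  ultimately obtain \<eta> where \<eta>: "\<eta> > 0" "\<And>t. \<lbrakk>t \<in> {0..T}; dist t T < \<eta>\<rbrakk> \<Longrightarrow> dist (\<psi> t) (2 * a) < a"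
    by auto
  have "u T \<in> U" using u \<open>T > 0\<close> by (auto simp: admissible_control_def)
  have "AE t in lebesgue_on {0..T}. T - \<eta> < t \<longrightarrow> a / c \<le> q \<bullet> w t"
    using max[unfolded maximizing_control_def] bound inside
  proof eventually_elim
    case (elim t)
    show ?case
    proof
      assume "T - \<eta> < t"
      then have "a < \<psi> t" using \<eta>(2)[of t] elim by (simp add: dist_real_def abs_less_iff)
      also have "\<dots> \<le> p t \<bullet> w t - norm (p T - p t) * W"
        using elim \<open>u T \<in> U\<close>
        by (auto simp: \<psi>_def w_def inner_add_right is_arg_max_def not_less)
      also have "\<dots> \<le> p t \<bullet> w t - norm (p T - p t) * norm (w t)"
        using elim by (intro diff_left_mono mult_left_mono) auto
      also have "\<dots> \<le> p t \<bullet> w t + (p T - p t) \<bullet> w t"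
        using norm_cauchy_schwarz[of "p t - p T" "w t"]
        by (simp add: norm_minus_commute[of "p T"] inner_diff_left)
      also have "\<dots> = c * (q \<bullet> w t)" using pT(1) by (simp add: inner_diff_left)
      finally show "a / c \<le> q \<bullet> w t" using pT(2) by (simp add: field_simps)
    qed
  qed
  then show False
    using \<open>a > 0\<close> pT(2)
    by (intro no_uniform_ascent_left[OF x_vel \<open>T > 0\<close> W(1) bound \<eta>(1) _ _ h safe]) auto
qed

text \<open>Nontriviality of an abnormal extremal provides a nonzero costate at some time only;
  backward uniqueness for the linear costate equation transfers this to \<open>T\<close>.\<close>

lemma costate_nonzero_at_end:
  fixes f :: "real^'n \<Rightarrow> real^'n" and g :: "real^'n \<Rightarrow> real^'m^'n"
  assumes f: "lipschitz_with_lipschitz_derivative f"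
    and g: "lipschitz_with_lipschitz_derivative g"
    and u: "admissible_control U T u" and p: "costate_trajectory f g u x {0..T} p"
    and t: "t \<in> {0..T}" "p t \<noteq> 0"
  shows "p T \<noteq> 0"
proof
  assume "p T = 0"
  obtain B0 where B0: "AE t in lebesgue_on {0..T}. norm (u t) \<le> B0"
    using u unfolding admissible_control_def by blast
  obtain K where K: "K \<ge> 0"
    "\<And>z v p. norm v \<le> max B0 0 \<Longrightarrow>
      norm (transpose (jacobian f (at z) + jacobian (\<lambda>y. g y *v v) (at z)) *v p) \<le> K * norm p"
    by (rule costate_velocity_bound[OF f g, of "max B0 0"]) auto
  have "T \<ge> 0" using t(1) by simp
  have "AE t in lebesgue_on {0..T}.
      norm (- (transpose (jacobian f (at (x t)) + jacobian (\<lambda>y. g y *v u t) (at (x t))) *v p t))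
      \<le> K * norm (p t)"
    using B0 by eventually_elim (simp only: norm_minus_cancel, rule K(2), simp)
  from has_velocity_ae_linear_zero[OF p[unfolded costate_trajectory_def] \<open>T \<ge> 0\<close> \<open>p T = 0\<close> K(1) this t(1)]
  have "p t = 0" .
  with t(2) show False by contradiction
qed

lemma costate_trajectory_scaleR:
  assumes "costate_trajectory f g u x J p"
  shows "costate_trajectory f g u x J (\<lambda>t. c *\<^sub>R p t)"
  using has_velocity_ae_scaleR[of p _ J c, OF assms[unfolded costate_trajectory_def]]
  unfolding costate_trajectory_def
  by (simp add: matrix_vector_mult_scaleR del: vector_transpose_matrix transpose_matrix_vector)

text \<open>Only a positive factor is allowed: a negative one would turn maximizers into
  minimizers.\<close>

lemma maximizing_control_scaleR:
  assumes "maximizing_control g U u x J p" "c > 0"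
  shows "maximizing_control g U u x J (\<lambda>t. c *\<^sub>R p t)"
  using assms unfolding maximizing_control_def is_arg_max_def by simp

(* A costate with p0 = 0 is determined by the extremality conditions only up to a positive factor,
   and the condition that p T is orthogonal to the tangent space of the boundary does not orient
   it along or against the gradient of h. Hence the factor c and the sign in the conclusion. *)

theorem corollary1:
  fixes f :: "real^'n \<Rightarrow> real^'n"
    and g :: "real^'n \<Rightarrow> real^'m^'n"
    and U :: "(real^'m) set"
    and S :: "(real^'n) set"
    and h :: "real^'n \<Rightarrow> real"
    and grad_h :: "real^'n \<Rightarrow> real^'n"
    and x0 :: "real^'n"
    and T p0 :: real
    and x p :: "real \<Rightarrow> real^'n"
    and u :: "real \<Rightarrow> real^'m"
  assumes f: "lipschitz_with_lipschitz_derivative f"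
    and g: "lipschitz_with_lipschitz_derivative g"
    and x0: "x0 \<in> S"
    and T: "T > 0"
    and extremal: "extremal f g U S x0 T x p p0 u"
    and A1: "dim (tangent_space (frontier S) (x T)) = CARD('n) - 1"
    and A2: "\<And>t. t \<in> {0..T} \<Longrightarrow> x t \<in> S"
    and A3: "\<exists>e>0. \<exists>x' u'. smooth_safe_extension f g U S T x u e x' u'"
    and A4: "S = {y. h y \<ge> 0}"
            "\<And>y. GDERIV h y :> grad_h y" "continuous_on UNIV grad_h"
            "surj (\<lambda>v. grad_h (x T) \<bullet> v)"
  shows "p0 = 0 \<and>
    (\<exists>c>0. let q = (\<lambda>t. c *\<^sub>R p t) in
        state_trajectory f g u {0..T} x \<and>
        costate_trajectory f g u x {0..T} q \<and>
        maximizing_control g U u x {0..T} q \<and>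
        h (x T) = 0 \<and>
        (q T = grad_h (x T) \<or> q T = - grad_h (x T)) \<and>
        q T \<bullet> (f (x T) + g (x T) *v u T) = 0)"
proof -
  let ?q = "grad_h (x T)"
  let ?v = "f (x T) + g (x T) *v u T"
  from extremal have
    u: "admissible_control U T u" and p0: "p0 \<in> {-1, 0}"
    and nontrivial: "p0 \<noteq> 0 \<or> (\<exists>t\<in>{0..T}. p t \<noteq> 0)"
    and x: "state_trajectory f g u {0..T} x"
    and p: "costate_trajectory f g u x {0..T} p"
    and max: "maximizing_control g U u x {0..T} p"
    and xT: "x T \<in> frontier S"
    and orth: "\<And>v. v \<in> tangent_space (frontier S) (x T) \<Longrightarrow> orthogonal (p T) v"
    and transversal: "p T \<bullet> ?v = - p0"
    unfolding extremal_def by simp_all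
  have "isCont h y" for y
    using A4(2)[of y] unfolding gderiv_def by (rule has_derivative_continuous)
  then have h_cont: "continuous_on UNIV h" by (simp add: continuous_at_imp_continuous_on)
  have hT: "h (x T) = 0"
    using subsetD[OF frontier_superlevel_subset[OF h_cont] xT[unfolded A4(1)]] by simp
  have "?q \<noteq> 0"
  proof
    assume "?q = 0"
    then have "range (\<lambda>v. ?q \<bullet> v) = {0}" by auto
    with A4(4) have "(1 :: real) \<in> {0}" by simp
    then show False by simp
  qed
  obtain c where c: "p T = c *\<^sub>R ?q"
  proof (rule orthogonal_to_codim1_parallel[OF \<open>?q \<noteq> 0\<close>])
    show "tangent_space (frontier S) (x T) \<subseteq> {v. ?q \<bullet> v = 0}"
      using tangent_space_frontier_subset[OF A4(2)[of "x T"] h_cont] A4(1) by simp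
  qed (use A1 orth in auto)
  have "p0 = 0"
  proof (rule ccontr)
    assume "p0 \<noteq> 0"
    then have one: "p T \<bullet> ?v = 1" using p0 transversal by auto
    obtain e x' u' where "e > 0" and ext: "smooth_safe_extension f g U S T x u e x' u'"
      using A3 by blast
    have "?q \<bullet> ?v \<ge> 0"
      by (rule safe_extension_final_velocity[OF f g T \<open>e > 0\<close> ext[unfolded A4(1)] A4(2) hT])
    have "c * (?q \<bullet> ?v) = 1" using one c by simp
    then have "0 < c * (?q \<bullet> ?v)" by simp
    with \<open>?q \<bullet> ?v \<ge> 0\<close> have "c > 0" by (simp add: zero_less_mult_iff)
    have "p T \<bullet> ?v \<le> 0"
    proof (rule maximizing_control_final_pairing_nonpos[OF f g T u x _ max A4(2)[of "x T"] hT _ c \<open>c > 0\<close>])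
      show "continuous_on {0..T} p"
        using p unfolding costate_trajectory_def by (rule has_velocity_ae_continuous_on)
      show "h (x t) \<ge> 0" if "t \<in> {0..T}" for t using A2[OF that] A4(1) by simp
    qed
    with one show False by simp
  qed
  then obtain t where "t \<in> {0..T}" "p t \<noteq> 0" using nontrivial by blast
  then have "p T \<noteq> 0" by (rule costate_nonzero_at_end[OF f g u p])
  then have "c \<noteq> 0" using c by auto
  \<comment> \<open>The absolute value keeps the factor positive, so the maximum condition survives
    the normalization; the sign of \<open>c\<close> remains as the sign in front of the
    gradient.\<close>
  define k where "k = 1 / \<bar>c\<bar>"
  have "k > 0" using \<open>c \<noteq> 0\<close> by (simp add: k_def)
  have "k *\<^sub>R p T = ?q \<or> k *\<^sub>R p T = - ?q"
    using c \<open>c \<noteq> 0\<close> by (cases "c > 0") (auto simp: k_def)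
  moreover have "(k *\<^sub>R p T) \<bullet> ?v = 0" using transversal \<open>p0 = 0\<close> by simp
  ultimately show ?thesis
    using \<open>p0 = 0\<close> \<open>k > 0\<close> x hT costate_trajectory_scaleR[OF p, of k]
      maximizing_control_scaleR[OF max \<open>k > 0\<close>]
    unfolding Let_def by (intro conjI exI[of _ k]) assumption+
qed

end
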